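(* Let $A$ be a real $n\times m$ matrix such that $\min_{\mathbf{y}\in\Delta_m}\max_{\mathbf{x}\in\Delta_n}\mathbf{x}^\top A\mathbf{y}$ has a unique optimal solution $(\mathbf{x}^*,\mathbf{y}^* )$. Then there exist constants $\eta_0\in(0,1)$, $c>0$, $C>0$ (depending only on $n,m,A$) such that for every $0<\eta<\eta_0$ the following holds for the OMWU dynamics with stepsize $\eta$ started at $(\mathbf{x}^1,\mathbf{y}^1)=(\mathbf{x}^0,\mathbf{y}^0)=(\tfrac1n\mathbf{1},\tfrac1m\mathbf{1})$: for every $t\ge2$, if $(\mathbf{x}^t,\mathbf{y}^t)$ is not $C\eta^{1/3}$-close, then $$D_{KL}\big((\mathbf{x}^*,\mathbf{y}^* )\,\|\,(\mathbf{x}^{t+1},\mathbf{y}^{t+1})\big)\le D_{KL}\big((\mathbf{x}^*,\mathbf{y}^* )\,\|\,(\mathbf{x}^{t},\mathbf{y}^{t})\big)-c\,\eta^3 .$$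
   Context: $\Delta_n\subset\mathbb{R}^n$ and $\Delta_m\subset\mathbb{R}^m$ are the probability simplices, and $\mathbf 1$ is the all-ones vector. An optimal solution of the min-max problem is a pair $(\mathbf{x}^*,\mathbf{y}^* )\in\Delta_n\times\Delta_m$ with $\mathbf{x}^\top A\mathbf{y}^*\le \mathbf{x}^{*\top}A\mathbf{y}^*\le\mathbf{x}^{*\top}A\mathbf{y}$ for all $\mathbf{x}\in\Delta_n$, $\mathbf{y}\in\Delta_m$. Optimistic Multiplicative-Weights Update (OMWU) dynamics with stepsize $\eta\in(0,1)$: given $(\mathbf{x}^1,\mathbf{y}^1),(\mathbf{x}^0,\mathbf{y}^0)\in\Delta_n\times\Delta_m$, for $t\ge1$, $$x_i^{t+1}=x_i^t\,\frac{e^{2\eta(A\mathbf{y}^t)_i-\eta(A\mathbf{y}^{t-1})_i}}{\sum_{j=1}^n x_j^t e^{2\eta(A\mathbf{y}^t)_j-\eta(A\mathbf{y}^{t-1})_j}}\ (i\in[n]),\qquad y_i^{t+1}=y_i^t\,\frac{e^{-2\eta(A^\top\mathbf{x}^t)_i+\eta(A^\top\mathbf{x}^{t-1})_i}}{\sum_{j=1}^m y_j^t e^{-2\eta(A^\top\mathbf{x}^t)_j+\eta(A^\top\mathbf{x}^{t-1})_j}}\ (i\in[m]).$$ $D_{KL}((\mathbf{x}^*,\mathbf{y}^* )\|(\mathbf{x},\mathbf{y}))=\sum_i x_i^*\ln(x_i^*/x_i)+\sum_j y_j^*\ln(y_j^*/y_j)$ (terms with $x_i^*=0$ or $y_j^*=0$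 are $0$). For $\alpha>0$, a point $(\mathbf{x},\mathbf{y})\in\Delta_n\times\Delta_m$ is $\alpha$-close if for each $i\in[n]$, $x_i\le\alpha$ or $|\mathbf{x}^\top A\mathbf{y}-(A\mathbf{y})_i|\le\alpha$, and for each $j\in[m]$, $y_j\le\alpha$ or $|\mathbf{x}^\top A\mathbf{y}-(A^\top\mathbf{x})_j|\le\alpha$. *)

theory Defs
  imports "HOL-Analysis.Analysis"
begin

definition prob_simplex :: "(real ^ 'k) set" where
  "prob_simplex = {x. (\<forall>i. 0 \<le> x $ i) \<and> (\<Sum>i\<in>UNIV. x $ i) = 1}"

(* A :: real ^ 'm ^ 'n is an n x m matrix: rows are indexed by 'n, columns by 'm.
   The x-player maximizes and the y-player minimizes. *)

definition payoff :: "real ^ 'm ^ 'n \<Rightarrow> real ^ 'n \<Rightarrow> real ^ 'm \<Rightarrow> real" where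
  "payoff A x y = x \<bullet> (A *v y)"

definition optimal_solution :: "real ^ 'm ^ 'n \<Rightarrow> real ^ 'n \<Rightarrow> real ^ 'm \<Rightarrow> bool" where
  "optimal_solution A xs ys \<longleftrightarrow>
     xs \<in> prob_simplex \<and> ys \<in> prob_simplex \<and>
     (\<forall>x\<in>prob_simplex. \<forall>y\<in>prob_simplex.
        payoff A x ys \<le> payoff A xs ys \<and> payoff A xs ys \<le> payoff A xs y)"

definition omwu_dynamics ::
  "real ^ 'm ^ 'n \<Rightarrow> real \<Rightarrow> (nat \<Rightarrow> real ^ 'n) \<Rightarrow> (nat \<Rightarrow> real ^ 'm) \<Rightarrow> bool" where
  "omwu_dynamics A \<eta> x y \<longleftrightarrow>
     (\<forall>t\<ge>1.
        (\<forall>i. x (t + 1) $ i =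
           x t $ i * (exp (2 * \<eta> * (A *v y t) $ i - \<eta> * (A *v y (t - 1)) $ i) /
             (\<Sum>j\<in>UNIV. x t $ j *
                exp (2 * \<eta> * (A *v y t) $ j - \<eta> * (A *v y (t - 1)) $ j)))) \<and>
        (\<forall>i. y (t + 1) $ i =
           y t $ i * (exp (- 2 * \<eta> * (transpose A *v x t) $ i
                           + \<eta> * (transpose A *v x (t - 1)) $ i) /
             (\<Sum>j\<in>UNIV. y t $ j *
                exp (- 2 * \<eta> * (transpose A *v x t) $ j
                     + \<eta> * (transpose A *v x (t - 1)) $ j)))))"

(* Terms with xs $ i = 0 vanish because of the factor. The value is meaningful only if
   x $ i > 0 whenever xs $ i > 0 (otherwise the divergence is infinite, whereas ln 0 = 0 here);
   this always holds along the dynamics started at the uniform point, where all coordinates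
   stay positive. *)

definition KL_div ::
  "real ^ 'n \<Rightarrow> real ^ 'm \<Rightarrow> real ^ 'n \<Rightarrow> real ^ 'm \<Rightarrow> real" where
  "KL_div xs ys x y =
     (\<Sum>i\<in>UNIV. xs $ i * ln (xs $ i / x $ i)) + (\<Sum>j\<in>UNIV. ys $ j * ln (ys $ j / y $ j))"

definition alpha_close ::
  "real ^ 'm ^ 'n \<Rightarrow> real \<Rightarrow> real ^ 'n \<Rightarrow> real ^ 'm \<Rightarrow> bool" where
  "alpha_close A \<alpha> x y \<longleftrightarrow>
     (\<forall>i. x $ i \<le> \<alpha> \<or> \<bar>payoff A x y - (A *v y) $ i\<bar> \<le> \<alpha>) \<and>
     (\<forall>j. y $ j \<le> \<alpha> \<or> \<bar>payoff A x y - (transpose A *v x) $ j\<bar> \<le> \<alpha>)"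

end

theory Submission
  imports Defs
begin

text \<open>
  With \<open>g\<^sup>t = A y\<^sup>t\<close> and \<open>h\<^sup>t = - A\<^sup>T x\<^sup>t\<close> both players perform the same update. The change of
  the divergence in one step is the sum of the two log-partition functions minus
  \<open>\<eta> (2 a\<^sup>t - a\<^sup>t\<^sup>-\<^sup>1)\<close>, where \<open>a\<^sup>t = x\<^sup>* A y\<^sup>t - x\<^sup>t A y\<^sup>* \<ge> 0\<close>. Consecutive iterates agree up to a factor
  \<open>1 + O(\<eta>)\<close> in every coordinate, so \<open>a\<^sup>t\<^sup>-\<^sup>1 \<le> 2 a\<^sup>t\<close> and this term only helps.

  The log-partition functions expand to \<open>\<eta>\<close> times their mean plus \<open>\<eta>\<^sup>2/2\<close> times the variance \<open>V\<close> of the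
  payoff vectors, up to \<open>O(\<eta>\<^sup>3)\<close>. Since the game is zero-sum the two means add up to
  \<open>(x\<^sup>t\<^sup>-\<^sup>1 - x\<^sup>t) \<bullet> g\<^sup>t + (y\<^sup>t\<^sup>-\<^sup>1 - y\<^sup>t) \<bullet> h\<^sup>t\<close>, and expanding the previous update backwards shows that this is
  \<open>- \<eta> V + O(\<eta>\<^sup>2)\<close>. Altogether the divergence changes by at most \<open>- \<eta>\<^sup>2 V / 2 + O(\<eta>\<^sup>3)\<close>, and a point that
  is not \<open>\<alpha>\<close>-close has \<open>V > \<alpha>\<^sup>3\<close>.
\<close>

section \<open>Means and variances\<close>

definition weighted_var :: "real ^ 'k \<Rightarrow> real ^ 'k \<Rightarrow> real" where
  "weighted_var p v = (\<Sum>i\<in>UNIV. p $ i * (v $ i - p \<bullet> v)\<^sup>2)"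

lemma prob_simplex_nonneg: "p \<in> prob_simplex \<Longrightarrow> 0 \<le> p $ i"
  and prob_simplex_sum: "p \<in> prob_simplex \<Longrightarrow> (\<Sum>i\<in>UNIV. p $ i) = 1"
  by (auto simp: prob_simplex_def)

lemma axis_in_prob_simplex: "axis k (1::real) \<in> prob_simplex"
  by (auto simp: prob_simplex_def axis_def)

lemma inner_eq_sum: "p \<bullet> v = (\<Sum>i\<in>UNIV. p $ i * v $ i)" for p v :: "real ^ 'k"
  by (simp add: inner_vec_def)

lemma simplex_sum_le:
  assumes "p \<in> prob_simplex" "\<And>i. f i \<le> B"
  shows "(\<Sum>i\<in>UNIV. p $ i * f i) \<le> B"
proof -
  have "(\<Sum>i\<in>UNIV. p $ i * f i) \<le> (\<Sum>i\<in>UNIV. p $ i * B)"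
    by (intro sum_mono mult_left_mono assms prob_simplex_nonneg)
  also have "\<dots> = B"
    using prob_simplex_sum[OF assms(1)] by (simp flip: sum_distrib_right)
  finally show ?thesis .
qed

lemma simplex_sum_ge:
  assumes "p \<in> prob_simplex" "\<And>i. B \<le> f i"
  shows "B \<le> (\<Sum>i\<in>UNIV. p $ i * f i)"
  using simplex_sum_le[OF assms(1), of "\<lambda>i. - f i" "- B"] assms(2) by (simp add: sum_negf)

lemma simplex_sum_abs_le:
  assumes "p \<in> prob_simplex" "\<And>i. \<bar>f i\<bar> \<le> B"
  shows "\<bar>\<Sum>i\<in>UNIV. p $ i * f i\<bar> \<le> B"
proof -
  have "(\<Sum>i\<in>UNIV. p $ i * f i) \<le> B"
    using assms by (intro simplex_sum_le) (auto simp: abs_le_iff)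
  moreover have "- B \<le> (\<Sum>i\<in>UNIV. p $ i * f i)"
    using assms by (intro simplex_sum_ge) (auto simp: abs_le_iff minus_le_iff)
  ultimately show ?thesis by (simp add: abs_le_iff)
qed

lemma deviation_abs_le:
  assumes "p \<in> prob_simplex" "\<And>i. \<bar>v $ i\<bar> \<le> B"
  shows "\<bar>v $ i - p \<bullet> v\<bar> \<le> 2 * B"
proof -
  have "\<bar>p \<bullet> v\<bar> \<le> B"
    unfolding inner_eq_sum by (rule simplex_sum_abs_le) (use assms in auto)
  with assms(2)[of i] show ?thesis by linarith
qed

lemma sum_deviation_eq_0:
  assumes "p \<in> prob_simplex"
  shows "(\<Sum>i\<in>UNIV. p $ i * (v $ i - p \<bullet> v)) = 0"
  using prob_simplex_sum[OF assms]
  by (simp add: right_diff_distrib sum_subtractf inner_eq_sum flip: sum_distrib_right)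

lemma weighted_var_nonneg: "p \<in> prob_simplex \<Longrightarrow> 0 \<le> weighted_var p v"
  unfolding weighted_var_def by (intro sum_nonneg mult_nonneg_nonneg prob_simplex_nonneg) auto

text \<open>Deviations from the mean average to zero, so one factor of the square may stay
  uncentred. The backward expansion of a step produces this covariance form.\<close>

lemma weighted_var_eq_covariance:
  assumes "p \<in> prob_simplex"
  shows "weighted_var p v = (\<Sum>i\<in>UNIV. p $ i * (v $ i - p \<bullet> v) * v $ i)"
proof -
  have "weighted_var p v =
      (\<Sum>i\<in>UNIV. p $ i * (v $ i - p \<bullet> v) * v $ i) - (\<Sum>i\<in>UNIV. p $ i * (v $ i - p \<bullet> v)) * (p \<bullet> v)"
    unfolding weighted_var_def sum_distrib_right sum_subtractf[symmetric]
    by (intro sum.cong refl) (simp add: power2_eq_square algebra_simps)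
  then show ?thesis by (simp add: sum_deviation_eq_0[OF assms])
qed

lemma weighted_var_scaleR: "weighted_var p (c *\<^sub>R v) = c\<^sup>2 * weighted_var p v"
  unfolding weighted_var_def sum_distrib_left
  by (intro sum.cong refl) (simp add: power2_eq_square algebra_simps)

text \<open>Serves to replace the variance of the extrapolated payoff
  \<open>2 *\<^sub>R g2 - g1\<close> by that of \<open>g2\<close>. A deviation is at most twice the
  sup bound, so the cross term costs at most \<open>2 * (2 * M) * (2 * D)\<close>.\<close>

lemma weighted_var_add_le:
  assumes p: "p \<in> prob_simplex" and v: "\<And>i. \<bar>v $ i\<bar> \<le> M" and d: "\<And>i. \<bar>d $ i\<bar> \<le> D"
  shows "weighted_var p (v + d) \<le> weighted_var p v + (8 * M * D + 4 * D\<^sup>2)"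
proof -
  have "weighted_var p (v + d) - weighted_var p v =
      (\<Sum>i\<in>UNIV. p $ i * (2 * ((v $ i - p \<bullet> v) * (d $ i - p \<bullet> d)) + (d $ i - p \<bullet> d)\<^sup>2))"
    unfolding weighted_var_def sum_subtractf[symmetric]
    by (intro sum.cong refl) (simp add: power2_eq_square algebra_simps inner_add_right)
  also have "\<dots> \<le> 8 * M * D + 4 * D\<^sup>2"
  proof (rule simplex_sum_le[OF p])
    fix i
    have dv: "\<bar>v $ i - p \<bullet> v\<bar> \<le> 2 * M" and dd: "\<bar>d $ i - p \<bullet> d\<bar> \<le> 2 * D"
      using deviation_abs_le p v d by blast+
    have "(v $ i - p \<bullet> v) * (d $ i - p \<bullet> d) \<le> \<bar>v $ i - p \<bullet> v\<bar> * \<bar>d $ i - p \<bullet> d\<bar>"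
      by (metis abs_ge_self abs_mult)
    also have "\<dots> \<le> (2 * M) * (2 * D)"
      using dv dd by (intro mult_mono) auto
    finally have "(v $ i - p \<bullet> v) * (d $ i - p \<bullet> d) \<le> 4 * (M * D)" by simp
    moreover have "(d $ i - p \<bullet> d)\<^sup>2 \<le> (2 * D)\<^sup>2"
      using dd by (metis abs_ge_zero power2_abs power_mono)
    ultimately show "2 * ((v $ i - p \<bullet> v) * (d $ i - p \<bullet> d)) + (d $ i - p \<bullet> d)\<^sup>2 \<le> 8 * M * D + 4 * D\<^sup>2"
      by (simp add: power_mult_distrib)
  qed
  finally show ?thesis by simp
qed

section \<open>Expansion of a multiplicative-weights step\<close>

lemma exp_le_cubic:
  fixes r :: real
  assumes "\<bar>r\<bar> \<le> 1 / 2"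
  shows "exp r \<le> 1 + r + r\<^sup>2 / 2 + \<bar>r\<bar> ^ 3"
proof -
  obtain t where t: "\<bar>t\<bar> \<le> \<bar>r\<bar>" and e: "exp r = (\<Sum>m<3. r ^ m / fact m) + exp t / fact 3 * r ^ 3"
    using Maclaurin_exp_le[of r 3] by blast
  have "exp t \<le> exp (1 / 2)" using t assms by simp
  then have t2: "exp t \<le> 2" using exp_half_le2 by linarith
  have "exp t / fact 3 * r ^ 3 \<le> \<bar>exp t / fact 3 * r ^ 3\<bar>" by (rule abs_ge_self)
  also have "\<dots> = (exp t / fact 3) * \<bar>r\<bar> ^ 3" by (simp add: abs_mult power_abs)
  also have "\<dots> \<le> 1 * \<bar>r\<bar> ^ 3"
    using t2 by (intro mult_right_mono) (auto simp: fact_numeral)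
  finally show ?thesis
    unfolding e by (simp add: eval_nat_numeral fact_numeral)
qed

text \<open>The backward expansion multiplies this error by payoffs of either sign, so its absolute
  value has to be controlled.\<close>

lemma exp_linear_error:
  fixes r :: real
  assumes "\<bar>r\<bar> \<le> 1 / 2"
  shows "\<bar>exp r - 1 - r\<bar> \<le> r\<^sup>2"
proof -
  obtain t where t: "\<bar>t\<bar> \<le> \<bar>r\<bar>" and e: "exp r = (\<Sum>m<2. r ^ m / fact m) + exp t / fact 2 * r ^ 2"
    using Maclaurin_exp_le[of r 2] by blast
  have "exp t \<le> exp (1 / 2)" using t assms by simp
  then have t2: "exp t \<le> 2" using exp_half_le2 by linarith
  have "exp r - 1 - r = (exp t / 2) * r\<^sup>2"
    unfolding e by (simp add: eval_nat_numeral)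
  moreover have "(exp t / 2) * r\<^sup>2 \<le> 1 * r\<^sup>2"
    using t2 by (intro mult_right_mono) auto
  moreover have "0 \<le> (exp t / 2) * r\<^sup>2" by simp
  ultimately show ?thesis by linarith
qed

section \<open>The multiplicative-weights map and its stability\<close>

definition partition_sum :: "real ^ 'k \<Rightarrow> real ^ 'k \<Rightarrow> real" where
  "partition_sum p s = (\<Sum>j\<in>UNIV. p $ j * exp (s $ j))"

text \<open>One map serves both players: \<open>s\<close> is the stepsize times the extrapolated
  payoff vector, and the minimizing player enters with negated payoffs.\<close>

definition mw_step :: "real ^ 'k \<Rightarrow> real ^ 'k \<Rightarrow> real ^ 'k" where
  "mw_step p s = (\<chi> i. p $ i * (exp (s $ i) / partition_sum p s))"

lemma partition_sum_pos:
  assumes "p \<in> prob_simplex"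
  shows "0 < partition_sum p s"
proof -
  obtain i where "p $ i \<noteq> 0"
    using prob_simplex_sum[OF assms] by (metis sum.neutral zero_neq_one)
  then have "0 < p $ i * exp (s $ i)"
    using prob_simplex_nonneg[OF assms, of i] by simp
  then show ?thesis unfolding partition_sum_def
    by (intro sum_pos2[of _ i]) (auto intro!: mult_nonneg_nonneg prob_simplex_nonneg[OF assms])
qed

lemma mw_step_in_prob_simplex:
  assumes "p \<in> prob_simplex"
  shows "mw_step p s \<in> prob_simplex"
proof -
  have "(\<Sum>i\<in>UNIV. mw_step p s $ i) = partition_sum p s / partition_sum p s"
    unfolding mw_step_def by (simp flip: sum_divide_distrib) (simp add: partition_sum_def)
  then show ?thesis
    using partition_sum_pos[OF assms, of s] prob_simplex_nonneg[OF assms]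
    by (auto simp: prob_simplex_def mw_step_def)
qed

lemma mw_step_pos:
  assumes "p \<in> prob_simplex" "0 < p $ i"
  shows "0 < mw_step p s $ i"
  using assms partition_sum_pos[OF assms(1), of s] by (simp add: mw_step_def)

text \<open>Numerator and denominator of the factor \<open>exp (s $ i) / partition_sum p s\<close>
  both lie between \<open>exp (- \<delta>)\<close> and \<open>exp \<delta>\<close>. The second claim
  bounds the old point by the new one, as needed to compare successive gaps.\<close>

lemma mw_step_stable:
  assumes p: "p \<in> prob_simplex" and s: "\<And>i. \<bar>s $ i\<bar> \<le> \<delta>" and \<delta>: "\<delta> \<le> 1 / 4"
  shows "\<bar>mw_step p s $ i - p $ i\<bar> \<le> 4 * \<delta> * p $ i" and "p $ i \<le> 2 * mw_step p s $ i"
proof -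
  let ?q = "mw_step p s $ i" and ?Z = "partition_sum p s"
  have Z: "0 < ?Z" by (rule partition_sum_pos[OF p])
  have \<delta>0: "0 \<le> \<delta>" using s[of i] by linarith
  have s': "s $ j \<le> \<delta>" "- \<delta> \<le> s $ j" for j using s[of j] by linarith+
  have Zu: "?Z \<le> exp \<delta>" unfolding partition_sum_def
    by (rule simplex_sum_le[OF p]) (simp add: s')
  have Zl: "exp (- \<delta>) \<le> ?Z" unfolding partition_sum_def
    by (rule simplex_sum_ge[OF p]) (simp add: s')
  have p0: "0 \<le> p $ i" by (rule prob_simplex_nonneg[OF p])
  have q: "?q = p $ i * (exp (s $ i) / ?Z)" by (simp add: mw_step_def)
  have "exp (s $ i) / ?Z \<le> exp \<delta> / exp (- \<delta>)"
    by (intro frac_le) (use Zl Z s' in auto)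
  also have "\<dots> = exp (2 * \<delta>)" by (simp flip: exp_diff)
  finally have u: "exp (s $ i) / ?Z \<le> exp (2 * \<delta>)" .
  have "exp (- \<delta>) / exp \<delta> \<le> exp (s $ i) / ?Z"
    by (intro frac_le) (use Zu Z s' in auto)
  moreover have "exp (- \<delta>) / exp \<delta> = exp (- (2 * \<delta>))" by (simp flip: exp_diff)
  ultimately have l: "exp (- (2 * \<delta>)) \<le> exp (s $ i) / ?Z" by simp
  have "exp (2 * \<delta>) \<le> 1 + 2 * \<delta> + (2 * \<delta>)\<^sup>2" using exp_bound[of "2 * \<delta>"] \<delta> \<delta>0 by simp
  also have "(2 * \<delta>)\<^sup>2 \<le> 2 * \<delta>"
    using \<delta> \<delta>0 mult_left_mono[of "2 * \<delta>" 1 "2 * \<delta>"] by (simp add: power2_eq_square)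
  finally have e: "exp (2 * \<delta>) \<le> 1 + 4 * \<delta>" by simp
  have e': "1 - 2 * \<delta> \<le> exp (- (2 * \<delta>))" using exp_ge_add_one_self[of "- (2 * \<delta>)"] by simp
  have ratio: "\<bar>exp (s $ i) / ?Z - 1\<bar> \<le> 4 * \<delta>" using u l e e' \<delta>0 by linarith
  have "\<bar>?q - p $ i\<bar> = p $ i * \<bar>exp (s $ i) / ?Z - 1\<bar>"
    using p0 unfolding q by (metis abs_mult abs_of_nonneg mult.right_neutral right_diff_distrib)
  also have "\<dots> \<le> p $ i * (4 * \<delta>)" by (rule mult_left_mono[OF ratio p0])
  finally show "\<bar>?q - p $ i\<bar> \<le> 4 * \<delta> * p $ i" by (simp add: mult_ac)
  have "1 / 2 \<le> exp (s $ i) / ?Z" using l e' \<delta> by linarith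
  from mult_left_mono[OF this p0] show "p $ i \<le> 2 * ?q" unfolding q by (simp add: mult_ac)
qed

text \<open>Factoring out the exponential of the mean leaves centred exponents, whose linear term
  averages to zero; \<open>ln W \<le> W - 1\<close> then reduces the claim to the expansion of
  \<open>exp\<close>. The error is \<open>(2 * \<delta>) ^ 3\<close>.\<close>

lemma ln_partition_sum_le:
  assumes p: "p \<in> prob_simplex" and s: "\<And>i. \<bar>s $ i\<bar> \<le> \<delta>" and \<delta>: "\<delta> \<le> 1 / 4"
  shows "ln (partition_sum p s) \<le> p \<bullet> s + weighted_var p s / 2 + 8 * \<delta> ^ 3"
proof -
  define r where "r i = s $ i - p \<bullet> s" for i
  have r: "\<bar>r i\<bar> \<le> 2 * \<delta>" for i unfolding r_def using deviation_abs_le p s by blast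
  let ?W = "\<Sum>i\<in>UNIV. p $ i * exp (r i)"
  have Z: "partition_sum p s = exp (p \<bullet> s) * ?W"
    unfolding partition_sum_def sum_distrib_left
    by (intro sum.cong refl) (simp add: r_def exp_diff)
  then have W0: "0 < ?W" using partition_sum_pos[OF p, of s] by (simp add: zero_less_mult_iff)
  have r2: "exp (r i) - r i - (r i)\<^sup>2 / 2 \<le> 1 + 8 * \<delta> ^ 3" for i
  proof -
    have "\<bar>r i\<bar> ^ 3 \<le> (2 * \<delta>) ^ 3" by (intro power_mono r) simp
    with exp_le_cubic[of "r i"] r[of i] \<delta> show ?thesis by (simp add: power_mult_distrib)
  qed
  have "?W - weighted_var p s / 2 =
      (\<Sum>i\<in>UNIV. p $ i * exp (r i)) - (\<Sum>i\<in>UNIV. p $ i * r i) - (\<Sum>i\<in>UNIV. p $ i * (r i)\<^sup>2) / 2"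
    using sum_deviation_eq_0[OF p, of s] unfolding r_def weighted_var_def by simp
  also have "\<dots> = (\<Sum>i\<in>UNIV. p $ i * (exp (r i) - r i - (r i)\<^sup>2 / 2))"
    by (simp add: sum_subtractf right_diff_distrib sum_divide_distrib)
  also have "\<dots> \<le> 1 + 8 * \<delta> ^ 3" by (rule simplex_sum_le[OF p r2])
  finally have "?W - 1 \<le> weighted_var p s / 2 + 8 * \<delta> ^ 3" by simp
  moreover have "ln ?W \<le> ?W - 1" by (rule ln_le_minus_one[OF W0])
  moreover have "ln (partition_sum p s) = p \<bullet> s + ln ?W"
    unfolding Z using W0 by (simp add: ln_mult)
  ultimately show ?thesis by linarith
qed

text \<open>Undoing the step shows \<open>p $ i\<close> proportional to
  \<open>q $ i * exp (- s $ i)\<close>, so to first order \<open>p - q\<close> is minus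
  \<open>q\<close> times the centred \<open>s\<close>. Expanding around \<open>q\<close> yields a
  covariance under the current strategy.\<close>

lemma mw_step_backward:
  assumes p: "p \<in> prob_simplex" and q_def: "q = mw_step p s"
    and s: "\<And>i. \<bar>s $ i\<bar> \<le> \<delta>" and \<delta>: "\<delta> \<le> 1 / 4" and v: "\<And>i. \<bar>v $ i\<bar> \<le> M"
  shows "(p - q) \<bullet> v \<le> 8 * \<delta>\<^sup>2 * M - (\<Sum>i\<in>UNIV. q $ i * (s $ i - q \<bullet> s) * v $ i)"
proof -
  have q: "q \<in> prob_simplex" unfolding q_def by (rule mw_step_in_prob_simplex[OF p])
  define r where "r i = s $ i - q \<bullet> s" for i
  define e where "e i = exp (- r i) - 1 + r i" for i
  \<comment> \<open>\<open>W\<close> normalizes the reversed step: it equals the sum of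
    \<open>q $ i * exp (- r i)\<close>, which is 1 up to second order because \<open>r\<close> has
    mean zero under \<open>q\<close>.\<close>
  define W where "W = exp (q \<bullet> s) / partition_sum p s"
  have r: "\<bar>r i\<bar> \<le> 2 * \<delta>" for i unfolding r_def using deviation_abs_le q s by blast
  have e: "\<bar>e i\<bar> \<le> 4 * \<delta>\<^sup>2" for i
  proof -
    have "\<bar>e i\<bar> \<le> (r i)\<^sup>2" unfolding e_def
      using exp_linear_error[of "- r i"] r[of i] \<delta> by simp
    also have "\<dots> \<le> (2 * \<delta>)\<^sup>2" using r[of i] by (metis abs_ge_zero power2_abs power_mono)
    finally show ?thesis by (simp add: power_mult_distrib)
  qed
  have pW: "p $ i * W = q $ i * exp (- r i)" for i
    unfolding q_def W_def r_def mw_step_def by (simp add: exp_diff)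
  have "W = (\<Sum>i\<in>UNIV. p $ i * W)"
    using prob_simplex_sum[OF p] by (simp flip: sum_distrib_right)
  also have "\<dots> = (\<Sum>i\<in>UNIV. q $ i) - (\<Sum>i\<in>UNIV. q $ i * r i) + (\<Sum>i\<in>UNIV. q $ i * e i)"
    unfolding pW e_def by (simp add: sum_subtractf[symmetric] sum.distrib[symmetric] algebra_simps)
  also have "\<dots> = 1 + (\<Sum>i\<in>UNIV. q $ i * e i)"
    using sum_deviation_eq_0[OF q, of s] prob_simplex_sum[OF q] unfolding r_def by simp
  finally have W: "\<bar>W - 1\<bar> \<le> 4 * \<delta>\<^sup>2"
    using simplex_sum_abs_le[OF q e] by simp
  \<comment> \<open>Moving the first-order term to the left leaves only \<open>e i\<close> and
    \<open>W - 1\<close>, both at most \<open>4 * \<delta>\<^sup>2\<close> in absolute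
    value.\<close>
  have eq: "(p $ i - q $ i) * v $ i + q $ i * r i * v $ i
      = q $ i * (e i * v $ i) - p $ i * ((W - 1) * v $ i)" for i
  proof -
    have "q $ i * e i = p $ i * W - q $ i + q $ i * r i"
      unfolding pW e_def by (simp add: algebra_simps)
    then have "(q $ i * e i) * v $ i = (p $ i * W - q $ i + q $ i * r i) * v $ i" by simp
    then show ?thesis by (simp add: algebra_simps)
  qed
  have "(p - q) \<bullet> v + (\<Sum>i\<in>UNIV. q $ i * r i * v $ i)
      = (\<Sum>i\<in>UNIV. q $ i * (e i * v $ i)) - (\<Sum>i\<in>UNIV. p $ i * ((W - 1) * v $ i))"
    unfolding inner_eq_sum sum.distrib[symmetric] sum_subtractf[symmetric]
    by (intro sum.cong refl) (simp add: eq)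
  moreover have "\<bar>\<Sum>i\<in>UNIV. q $ i * (e i * v $ i)\<bar> \<le> 4 * \<delta>\<^sup>2 * M"
    by (rule simplex_sum_abs_le[OF q]) (auto simp: abs_mult intro!: mult_mono e v)
  moreover have "\<bar>\<Sum>i\<in>UNIV. p $ i * ((W - 1) * v $ i)\<bar> \<le> 4 * \<delta>\<^sup>2 * M"
    by (rule simplex_sum_abs_le[OF p]) (auto simp: abs_mult intro!: mult_mono W v)
  ultimately show ?thesis unfolding r_def by linarith
qed

text \<open>
  The estimate for one player: \<open>p\<close> and \<open>q\<close> are the previous and the current strategy, and
  \<open>g0\<close>, \<open>g1\<close>, \<open>g2\<close> are the last three payoff vectors, \<open>g2\<close> being the current one.
\<close>

lemma optimistic_ln_partition_sum_le:
  assumes p: "p \<in> prob_simplex" and q_def: "q = mw_step p (\<eta> *\<^sub>R (2 *\<^sub>R g1 - g0))"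
    and g0: "\<And>i. \<bar>g0 $ i\<bar> \<le> M" and g1: "\<And>i. \<bar>g1 $ i\<bar> \<le> M" and g2: "\<And>i. \<bar>g2 $ i\<bar> \<le> M"
    and d1: "\<And>i. \<bar>(g1 - g0) $ i\<bar> \<le> 12 * M\<^sup>2 * \<eta>" and d2: "\<And>i. \<bar>(g2 - g1) $ i\<bar> \<le> 12 * M\<^sup>2 * \<eta>"
    and \<eta>: "0 < \<eta>" "12 * M * \<eta> \<le> 1"
  shows "ln (partition_sum q (\<eta> *\<^sub>R (2 *\<^sub>R g2 - g1)))
    \<le> \<eta> * (q \<bullet> (2 *\<^sub>R g2 - g1)) - \<eta> * ((p - q) \<bullet> g2) - \<eta>\<^sup>2 / 2 * weighted_var q g2 + 408 * M ^ 3 * \<eta> ^ 3"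
proof -
  have q: "q \<in> prob_simplex" unfolding q_def by (rule mw_step_in_prob_simplex[OF p])
  have M: "0 \<le> M" using g0[of undefined] by linarith
  define \<delta> where "\<delta> = 3 * M * \<eta>"
  define D where "D = 12 * M\<^sup>2 * \<eta>"
  have \<delta>: "\<delta> \<le> 1 / 4" unfolding \<delta>_def using \<eta> by simp
  have bound: "\<bar>(\<eta> *\<^sub>R (2 *\<^sub>R g - g')) $ i\<bar> \<le> \<delta>"
    if "\<bar>g $ i\<bar> \<le> M" "\<bar>g' $ i\<bar> \<le> M" for g g' :: "real ^ 'a" and i
  proof -
    have "\<bar>(\<eta> *\<^sub>R (2 *\<^sub>R g - g')) $ i\<bar> = \<eta> * \<bar>2 * g $ i - g' $ i\<bar>" using \<eta> by (simp add: abs_mult)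
    also have "\<dots> \<le> \<eta> * (3 * M)" using that \<eta> by (intro mult_left_mono) linarith+
    finally show ?thesis by (simp add: \<delta>_def mult_ac)
  qed
  let ?V = "weighted_var q g2"

  have "weighted_var q (2 *\<^sub>R g2 - g1) = weighted_var q (g2 + (g2 - g1))"
    by (simp add: scaleR_2 algebra_simps)
  also have "\<dots> \<le> ?V + (8 * M * D + 4 * D\<^sup>2)"
    using d2 unfolding D_def by (intro weighted_var_add_le q g2)
  \<comment> \<open>The stepsize condition absorbs one factor \<open>12 * M * \<eta>\<close>, so the
    square costs no more than first order in \<eta>.\<close>
  also have "D\<^sup>2 \<le> 12 * M ^ 3 * \<eta>"
  proof -
    have "D\<^sup>2 = (12 * M ^ 3 * \<eta>) * (12 * M * \<eta>)" by (simp add: D_def power_numeral_reduce)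
    also have "\<dots> \<le> (12 * M ^ 3 * \<eta>) * 1" using M \<eta> by (intro mult_left_mono) auto
    finally show ?thesis by simp
  qed
  finally have var: "weighted_var q (2 *\<^sub>R g2 - g1) \<le> ?V + 144 * M ^ 3 * \<eta>"
    by (simp add: D_def power_numeral_reduce)
  have "ln (partition_sum q (\<eta> *\<^sub>R (2 *\<^sub>R g2 - g1)))
      \<le> \<eta> * (q \<bullet> (2 *\<^sub>R g2 - g1)) + \<eta>\<^sup>2 / 2 * weighted_var q (2 *\<^sub>R g2 - g1) + 8 * \<delta> ^ 3"
    using ln_partition_sum_le[OF q bound[OF g2 g1] \<delta>] unfolding weighted_var_scaleR by simp
  also have "\<eta>\<^sup>2 / 2 * weighted_var q (2 *\<^sub>R g2 - g1) \<le> \<eta>\<^sup>2 / 2 * (?V + 144 * M ^ 3 * \<eta>)"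
    using var by (intro mult_left_mono) auto
  finally have 1: "ln (partition_sum q (\<eta> *\<^sub>R (2 *\<^sub>R g2 - g1)))
      \<le> \<eta> * (q \<bullet> (2 *\<^sub>R g2 - g1)) + \<eta>\<^sup>2 / 2 * ?V + 288 * M ^ 3 * \<eta> ^ 3"
    by (simp add: \<delta>_def power_numeral_reduce algebra_simps)

  define s where "s = \<eta> *\<^sub>R (2 *\<^sub>R g1 - g0)"
  \<comment> \<open>The step from \<open>p\<close> to \<open>q\<close> was driven by
    \<open>g2\<close> up to the two drifts collected in \<open>d\<close>, so its covariance with
    \<open>g2\<close> is \<eta> times the variance up to second order.\<close>
  define d where "d = (g1 - g2) + (g1 - g0)"
  have s: "s = \<eta> *\<^sub>R (g2 + d)" by (simp add: s_def d_def scaleR_2 algebra_simps)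
  have "\<bar>d $ i\<bar> \<le> 2 * D" for i
    using d1[of i] d2[of i] unfolding d_def D_def by simp
  then have dd: "\<bar>d $ i - q \<bullet> d\<bar> \<le> 2 * (2 * D)" for i by (rule deviation_abs_le[OF q])
  have cov: "\<bar>\<Sum>i\<in>UNIV. q $ i * ((d $ i - q \<bullet> d) * g2 $ i)\<bar> \<le> 2 * (2 * D) * M"
    by (rule simplex_sum_abs_le[OF q]) (simp only: abs_mult, intro mult_mono dd g2 order_trans[OF abs_ge_zero dd] abs_ge_zero)
  have "(\<Sum>i\<in>UNIV. q $ i * (s $ i - q \<bullet> s) * g2 $ i)
      = \<eta> * ((\<Sum>i\<in>UNIV. q $ i * (g2 $ i - q \<bullet> g2) * g2 $ i) + (\<Sum>i\<in>UNIV. q $ i * ((d $ i - q \<bullet> d) * g2 $ i)))"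
    unfolding sum.distrib[symmetric] sum_distrib_left s
    by (intro sum.cong refl) (simp add: algebra_simps inner_add_right)
  also have "\<dots> = \<eta> * (?V + (\<Sum>i\<in>UNIV. q $ i * ((d $ i - q \<bullet> d) * g2 $ i)))"
    by (simp add: weighted_var_eq_covariance[OF q])
  also have "\<dots> \<ge> \<eta> * (?V - 4 * D * M)"
    using cov \<eta> by (intro mult_left_mono) auto
  finally have c: "\<eta> * (?V - 4 * D * M) \<le> (\<Sum>i\<in>UNIV. q $ i * (s $ i - q \<bullet> s) * g2 $ i)" .
  have "(p - q) \<bullet> g2 \<le> 8 * \<delta>\<^sup>2 * M - (\<Sum>i\<in>UNIV. q $ i * (s $ i - q \<bullet> s) * g2 $ i)"
    using bound[OF g1 g0] unfolding s_def by (intro mw_step_backward[OF p q_def _ \<delta> g2])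
  with c have "(p - q) \<bullet> g2 \<le> 8 * \<delta>\<^sup>2 * M - \<eta> * (?V - 4 * D * M)" by linarith
  then have "\<eta> * ((p - q) \<bullet> g2) \<le> \<eta> * (8 * \<delta>\<^sup>2 * M - \<eta> * (?V - 4 * D * M))"
    using \<eta> by (intro mult_left_mono) auto
  also have "\<dots> = 120 * M ^ 3 * \<eta> ^ 3 - \<eta>\<^sup>2 * ?V"
    by (simp add: \<delta>_def D_def power_numeral_reduce algebra_simps)
  \<comment> \<open>The log-partition bound has plus half the variance and the backward step minus
    all of it, leaving minus one half. The errors add up to 288 + 120 = 408.\<close>
  finally show ?thesis using 1 by simp
qed

section \<open>The divergence along the dynamics\<close>

text \<open>The logarithm turns the update factor into the summands \<open>- s $ i\<close> and
  \<open>ln (partition_sum p s)\<close>. Positivity of \<open>p\<close> lets it split; coordinates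
  with \<open>z $ i = 0\<close> vanish on both sides.\<close>

lemma sum_ln_ratio_mw_step:
  assumes z: "z \<in> prob_simplex" and p: "p \<in> prob_simplex" and pos: "\<And>i. 0 < p $ i"
  shows "(\<Sum>i\<in>UNIV. z $ i * ln (z $ i / mw_step p s $ i))
    = (\<Sum>i\<in>UNIV. z $ i * ln (z $ i / p $ i)) - z \<bullet> s + ln (partition_sum p s)"
proof -
  let ?Z = "partition_sum p s"
  have Z: "0 < ?Z" by (rule partition_sum_pos[OF p])
  have "z $ i * ln (z $ i / mw_step p s $ i)
      = z $ i * ln (z $ i / p $ i) - z $ i * s $ i + z $ i * ln ?Z" for i
  proof (cases "z $ i = 0")
    case False
    then have zi: "0 < z $ i" using prob_simplex_nonneg[OF z, of i] by linarith
    have "ln (z $ i / mw_step p s $ i) = ln (z $ i / p $ i) - s $ i + ln ?Z"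
      using zi pos[of i] Z by (simp add: mw_step_def ln_div ln_mult)
    then show ?thesis by (simp only: distrib_left right_diff_distrib)
  qed simp
  then have "(\<Sum>i\<in>UNIV. z $ i * ln (z $ i / mw_step p s $ i))
      = (\<Sum>i\<in>UNIV. z $ i * ln (z $ i / p $ i)) - z \<bullet> s + (\<Sum>i\<in>UNIV. z $ i) * ln ?Z"
    by (simp add: sum.distrib sum_subtractf inner_eq_sum sum_distrib_right)
  then show ?thesis using prob_simplex_sum[OF z] by simp
qed

text \<open>A single coordinate with mass and deviation above \<alpha> already contributes more than
  \<alpha> times its square. This cube is the source of the exponent 1/3 in the closeness
  radius.\<close>

lemma weighted_var_gt:
  assumes p: "p \<in> prob_simplex" and "0 < \<alpha>" "\<alpha> < p $ i" "\<alpha> < \<bar>v $ i - p \<bullet> v\<bar>"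
  shows "\<alpha> ^ 3 < weighted_var p v"
proof -
  have "\<alpha> ^ 3 = \<alpha> * \<alpha>\<^sup>2" by (simp add: power_numeral_reduce)
  also have "\<dots> < p $ i * \<bar>v $ i - p \<bullet> v\<bar>\<^sup>2"
    using assms by (intro mult_strict_mono power_strict_mono) auto
  also have "\<dots> \<le> weighted_var p v"
    unfolding weighted_var_def power2_abs
    by (rule member_le_sum) (auto intro!: mult_nonneg_nonneg prob_simplex_nonneg[OF p])
  finally show ?thesis .
qed

lemma payoff_transpose: "payoff A x y = y \<bullet> (transpose A *v x)"
  by (metis payoff_def dot_lmul_matrix inner_commute transpose_matrix_vector)

lemma not_alpha_close_weighted_var:
  assumes x: "x \<in> prob_simplex" and y: "y \<in> prob_simplex" and \<alpha>: "0 < \<alpha>"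
    and n: "\<not> alpha_close A \<alpha> x y"
  shows "\<alpha> ^ 3 < weighted_var x (A *v y) + weighted_var y (- (transpose A *v x))"
proof -
  have py: "y \<bullet> - (transpose A *v x) = - payoff A x y"
    by (simp add: payoff_transpose)
  from n consider (x) i where "\<alpha> < x $ i" "\<alpha> < \<bar>(A *v y) $ i - x \<bullet> (A *v y)\<bar>"
    | (y) j where "\<alpha> < y $ j" "\<alpha> < \<bar>(- (transpose A *v x)) $ j - y \<bullet> - (transpose A *v x)\<bar>"
    unfolding alpha_close_def py by (auto simp: not_le payoff_def abs_minus_commute)
  then show ?thesis
  proof cases
    case x
    with weighted_var_gt[OF assms(1) \<alpha>] weighted_var_nonneg[OF y] show ?thesis
      by (meson add_increasing2 less_le_trans order_refl)
  next
    case y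
    with weighted_var_gt[OF assms(2) \<alpha>] weighted_var_nonneg[OF x] show ?thesis
      by (meson add_increasing less_le_trans order_refl)
  qed
qed

text \<open>Applied with \<open>B = 1\<close> to strategies, to bound payoffs, and with
  \<open>B = 4 * \<delta>\<close> to differences of successive iterates, to bound the payoff
  drift.\<close>

lemma abs_matrix_vector_le:
  fixes A :: "real ^ 'm ^ 'n"
  assumes "\<And>i j. \<bar>A $ i $ j\<bar> \<le> M" and "(\<Sum>j\<in>UNIV. \<bar>v $ j\<bar>) \<le> B" and "0 \<le> M"
  shows "\<bar>(A *v v) $ i\<bar> \<le> M * B"
proof -
  have "\<bar>(A *v v) $ i\<bar> \<le> (\<Sum>j\<in>UNIV. \<bar>A $ i $ j * v $ j\<bar>)"
    unfolding matrix_vector_mult_def by (simp add: sum_abs)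
  also have "\<dots> \<le> (\<Sum>j\<in>UNIV. M * \<bar>v $ j\<bar>)"
    unfolding abs_mult by (intro sum_mono mult_right_mono assms) auto
  also have "\<dots> \<le> M * B" unfolding sum_distrib_left[symmetric] by (intro mult_left_mono assms)
  finally show ?thesis .
qed

text \<open>Optimality is tested against pure strategies, the vertices of the simplex. These signs
  make the gap below a nonnegative combination.\<close>

lemma optimal_solution_gaps:
  assumes "optimal_solution A xs ys"
  shows "(A *v ys) $ i \<le> payoff A xs ys" and "payoff A xs ys \<le> (transpose A *v xs) $ j"
proof -
  have "payoff A (axis i 1) ys \<le> payoff A xs ys"
    using assms axis_in_prob_simplex unfolding optimal_solution_def by blast
  then show "(A *v ys) $ i \<le> payoff A xs ys" by (simp add: payoff_def inner_axis')
  have "payoff A xs ys \<le> payoff A xs (axis j 1)"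
    using assms axis_in_prob_simplex unfolding optimal_solution_def by blast
  also have "\<dots> = (transpose A *v xs) $ j"
    by (simp add: payoff_transpose inner_axis')
  finally show "payoff A xs ys \<le> (transpose A *v xs) $ j" .
qed

lemma abs_diff_mw_step_sum_le:
  assumes p: "p \<in> prob_simplex" and s: "\<And>i. \<bar>s $ i\<bar> \<le> \<delta>" and \<delta>: "\<delta> \<le> 1 / 4"
  shows "(\<Sum>i\<in>UNIV. \<bar>(mw_step p s - p) $ i\<bar>) \<le> 4 * \<delta>"
proof -
  have "(\<Sum>i\<in>UNIV. \<bar>(mw_step p s - p) $ i\<bar>) \<le> (\<Sum>i\<in>UNIV. 4 * \<delta> * p $ i)"
    using mw_step_stable(1)[OF assms] by (intro sum_mono) simp
  also have "\<dots> = 4 * \<delta>" using prob_simplex_sum[OF p] by (simp flip: sum_distrib_left)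
  finally show ?thesis .
qed

section \<open>Iterates of the dynamics and their gap\<close>

lemma omwu_dynamics_mw_step:
  assumes "omwu_dynamics A \<eta> x y" "1 \<le> t"
  shows "x (t + 1) = mw_step (x t) (\<eta> *\<^sub>R (2 *\<^sub>R (A *v y t) - A *v y (t - 1)))"
    and "y (t + 1) = mw_step (y t)
      (\<eta> *\<^sub>R (2 *\<^sub>R - (transpose A *v x t) - - (transpose A *v x (t - 1))))"
  using assms unfolding omwu_dynamics_def mw_step_def partition_sum_def vec_eq_iff
  by (simp_all add: algebra_simps)

lemma uniform_in_prob_simplex: "(\<chi> i. 1 / real CARD('k)) \<in> (prob_simplex :: (real ^ 'k) set)"
  by (simp add: prob_simplex_def)

lemma omwu_dynamics_interior:
  fixes A :: "real ^ 'm ^ 'n"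
  assumes dyn: "omwu_dynamics A \<eta> x y"
    and x0: "x 0 = (\<chi> i. 1 / real CARD('n))" and x1: "x 1 = (\<chi> i. 1 / real CARD('n))"
    and y0: "y 0 = (\<chi> j. 1 / real CARD('m))" and y1: "y 1 = (\<chi> j. 1 / real CARD('m))"
  shows "x t \<in> prob_simplex \<and> y t \<in> prob_simplex \<and> (\<forall>i. 0 < x t $ i) \<and> (\<forall>j. 0 < y t $ j)"
proof (induction t)
  case 0
  show ?case by (simp add: x0 y0 uniform_in_prob_simplex)
next
  case (Suc t)
  show ?case
  \<comment> \<open>The recursion determines iterates only from index 2 on, so index 1 also rests on
    the initial condition.\<close>
  proof (cases "t = 0")
    case True
    then show ?thesis using x1 y1 by (simp add: uniform_in_prob_simplex)
  next
    case False
    then show ?thesis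
      using omwu_dynamics_mw_step[OF dyn, of t] Suc by (simp add: mw_step_in_prob_simplex mw_step_pos)
  qed
qed

text \<open>
  The gap \<open>a = x\<^sup>* A y - x A y\<^sup>*\<close> is a combination of the coordinates of \<open>x\<close> and \<open>y\<close> with nonnegative
  coefficients, hence monotone in them.
\<close>

lemma optimal_gap_mono:
  assumes opt: "optimal_solution A xs ys"
    and p: "p \<in> prob_simplex" "p' \<in> prob_simplex" and q: "q \<in> prob_simplex" "q' \<in> prob_simplex"
    and pq: "\<And>i. p $ i \<le> c * p' $ i" "\<And>j. q $ j \<le> c * q' $ j"
  shows "payoff A xs q - payoff A p ys \<le> c * (payoff A xs q' - payoff A p' ys)"
proof -
  let ?v = "payoff A xs ys"
  have gap: "payoff A xs q - payoff A p ys =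
      (\<Sum>j\<in>UNIV. q $ j * ((transpose A *v xs) $ j - ?v)) + (\<Sum>i\<in>UNIV. p $ i * (?v - (A *v ys) $ i))"
    if "p \<in> prob_simplex" "q \<in> prob_simplex" for p q
    using that[THEN prob_simplex_sum] unfolding payoff_transpose[of A xs q] payoff_def[of A p ys] inner_eq_sum
    by (simp add: right_diff_distrib sum_subtractf flip: sum_distrib_right)
  have "(\<Sum>j\<in>UNIV. q $ j * ((transpose A *v xs) $ j - ?v))
      \<le> (\<Sum>j\<in>UNIV. (c * q' $ j) * ((transpose A *v xs) $ j - ?v))"
    using optimal_solution_gaps(2)[OF opt] by (intro sum_mono mult_right_mono pq) simp
  moreover have "(\<Sum>i\<in>UNIV. p $ i * (?v - (A *v ys) $ i))
      \<le> (\<Sum>i\<in>UNIV. (c * p' $ i) * (?v - (A *v ys) $ i))"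
    using optimal_solution_gaps(1)[OF opt] by (intro sum_mono mult_right_mono pq) simp
  ultimately show ?thesis
    unfolding gap[OF p(1) q(1)] gap[OF p(2) q(2)] by (simp add: sum_distrib_left distrib_left mult.assoc)
qed

text \<open>Joins the two one-player estimates, whence 816 = 2 * 408. The condition
  \<open>2 \<le> t\<close> makes iterate \<open>t\<close> itself the result of an update, as the
  backward expansion requires.\<close>

lemma KL_div_omwu_step:
  fixes A :: "real ^ 'm ^ 'n"
  assumes opt: "optimal_solution A xs ys"
    and M: "\<And>i j. \<bar>A $ i $ j\<bar> \<le> M" and \<eta>: "0 < \<eta>" "12 * M * \<eta> \<le> 1"
    and dyn: "omwu_dynamics A \<eta> x y"
    and x0: "x 0 = (\<chi> i. 1 / real CARD('n))" and x1: "x 1 = (\<chi> i. 1 / real CARD('n))"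
    and y0: "y 0 = (\<chi> j. 1 / real CARD('m))" and y1: "y 1 = (\<chi> j. 1 / real CARD('m))"
    and t: "2 \<le> t"
  shows "KL_div xs ys (x (t + 1)) (y (t + 1)) \<le> KL_div xs ys (x t) (y t)
    - \<eta>\<^sup>2 / 2 * (weighted_var (x t) (A *v y t) + weighted_var (y t) (- (transpose A *v x t)))
    + 816 * M ^ 3 * \<eta> ^ 3"
proof -
  define G where "G t = A *v y t" for t
  define H where "H t = - (transpose A *v x t)" for t
  note inv = omwu_dynamics_interior[OF dyn x0 x1 y0 y1]
  have xS: "x t \<in> prob_simplex" and yS: "y t \<in> prob_simplex"
    and xp: "0 < x t $ i" and yp: "0 < y t $ j" for t i j
    using inv[of t] by auto
  have xsS: "xs \<in> prob_simplex" and ysS: "ys \<in> prob_simplex"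
    using opt by (auto simp: optimal_solution_def)
  have M0: "0 \<le> M" using M[of undefined undefined] by linarith
  have MT: "\<bar>transpose A $ j $ i\<bar> \<le> M" for i j using M by (simp add: transpose_def)
  have step: "x (Suc t) = mw_step (x t) (\<eta> *\<^sub>R (2 *\<^sub>R G t - G (t - 1)))"
    "y (Suc t) = mw_step (y t) (\<eta> *\<^sub>R (2 *\<^sub>R H t - H (t - 1)))" if "1 \<le> t" for t
    using omwu_dynamics_mw_step[OF dyn that] by (simp_all add: G_def H_def)
  have xB: "(\<Sum>i\<in>UNIV. \<bar>x t $ i\<bar>) \<le> 1" and yB: "(\<Sum>i\<in>UNIV. \<bar>y t $ i\<bar>) \<le> 1" for t
    using prob_simplex_sum[OF xS[of t]] prob_simplex_sum[OF yS[of t]]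
    by (simp_all add: prob_simplex_nonneg[OF xS] prob_simplex_nonneg[OF yS])
  have GM: "\<bar>G t $ i\<bar> \<le> M" for t i
    using abs_matrix_vector_le[OF M yB M0] by (simp add: G_def)
  have HM: "\<bar>H t $ i\<bar> \<le> M" for t i
    using abs_matrix_vector_le[OF MT xB M0] by (simp add: H_def)

  define \<delta> where "\<delta> = 3 * M * \<eta>"
  have \<delta>: "\<delta> \<le> 1 / 4" using \<eta> by (simp add: \<delta>_def)
  have bound: "\<bar>\<eta> * (2 * a - b)\<bar> \<le> \<delta>" if "\<bar>a\<bar> \<le> M" "\<bar>b\<bar> \<le> M" for a b
  proof -
    have "\<bar>\<eta> * (2 * a - b)\<bar> = \<eta> * \<bar>2 * a - b\<bar>" using \<eta> by (simp add: abs_mult)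
    also have "\<dots> \<le> \<eta> * (3 * M)" using that \<eta> by (intro mult_left_mono) linarith+
    finally show ?thesis by (simp add: \<delta>_def mult_ac)
  qed
  have GB: "\<bar>(\<eta> *\<^sub>R (2 *\<^sub>R G t - G (t - 1))) $ i\<bar> \<le> \<delta>" for t i
    using bound[OF GM GM] by simp
  have HB: "\<bar>(\<eta> *\<^sub>R (2 *\<^sub>R H t - H (t - 1))) $ i\<bar> \<le> \<delta>" for t i
    using bound[OF HM HM] by simp
  have drift: "(\<Sum>i\<in>UNIV. \<bar>(x (Suc t) - x t) $ i\<bar>) \<le> 4 * \<delta>"
    "(\<Sum>i\<in>UNIV. \<bar>(y (Suc t) - y t) $ i\<bar>) \<le> 4 * \<delta>" for t
  \<comment> \<open>Iterates 0 and 1 are not linked by an update, but they coincide.\<close>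
  proof (atomize (full), cases "t = 0")
    case True
    then show "(\<Sum>i\<in>UNIV. \<bar>(x (Suc t) - x t) $ i\<bar>) \<le> 4 * \<delta> \<and>
        (\<Sum>i\<in>UNIV. \<bar>(y (Suc t) - y t) $ i\<bar>) \<le> 4 * \<delta>"
      using x0 x1 y0 y1 M0 \<eta> by (simp add: \<delta>_def)
  next
    case False
    then show "(\<Sum>i\<in>UNIV. \<bar>(x (Suc t) - x t) $ i\<bar>) \<le> 4 * \<delta> \<and>
        (\<Sum>i\<in>UNIV. \<bar>(y (Suc t) - y t) $ i\<bar>) \<le> 4 * \<delta>"
      using abs_diff_mw_step_sum_le[OF xS GB \<delta>] abs_diff_mw_step_sum_le[OF yS HB \<delta>] step[of t] by simp
  qed
  have Gd: "\<bar>(G (Suc t) - G t) $ i\<bar> \<le> 12 * M\<^sup>2 * \<eta>" for t i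
    using abs_matrix_vector_le[OF M drift(2) M0, of t i]
    by (simp add: G_def \<delta>_def power2_eq_square mult_ac matrix_vector_mult_diff_distrib)
  have Hd: "\<bar>(H (Suc t) - H t) $ i\<bar> \<le> 12 * M\<^sup>2 * \<eta>" for t i
    using abs_matrix_vector_le[OF MT drift(1) M0, of t i]
    by (simp add: H_def \<delta>_def power2_eq_square mult_ac matrix_vector_mult_diff_distrib abs_minus_commute)

  obtain k where k: "t = Suc (Suc k)" using t by (metis add_2_eq_Suc le_Suc_ex)
  let ?xp = "x (Suc k)" and ?x = "x t" and ?yp = "y (Suc k)" and ?y = "y t"
  let ?gp = "G (Suc k)" and ?g = "G t" and ?hp = "H (Suc k)" and ?h = "H t"
  have sx: "x (t + 1) = mw_step ?x (\<eta> *\<^sub>R (2 *\<^sub>R ?g - ?gp))"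
    and sy: "y (t + 1) = mw_step ?y (\<eta> *\<^sub>R (2 *\<^sub>R ?h - ?hp))"
    using step[of t] k by simp_all
  have px: "?x = mw_step ?xp (\<eta> *\<^sub>R (2 *\<^sub>R ?gp - G k))"
    and py: "?y = mw_step ?yp (\<eta> *\<^sub>R (2 *\<^sub>R ?hp - H k))"
    using step[of "Suc k"] k by simp_all
  have lx: "ln (partition_sum ?x (\<eta> *\<^sub>R (2 *\<^sub>R ?g - ?gp)))
    \<le> \<eta> * (?x \<bullet> (2 *\<^sub>R ?g - ?gp)) - \<eta> * ((?xp - ?x) \<bullet> ?g) - \<eta>\<^sup>2 / 2 * weighted_var ?x ?g + 408 * M ^ 3 * \<eta> ^ 3"
    using Gd[of "Suc k"]
    by (intro optimistic_ln_partition_sum_le[OF xS px GM GM GM Gd _ \<eta>]) (simp add: k)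
  have ly: "ln (partition_sum ?y (\<eta> *\<^sub>R (2 *\<^sub>R ?h - ?hp)))
    \<le> \<eta> * (?y \<bullet> (2 *\<^sub>R ?h - ?hp)) - \<eta> * ((?yp - ?y) \<bullet> ?h) - \<eta>\<^sup>2 / 2 * weighted_var ?y ?h + 408 * M ^ 3 * \<eta> ^ 3"
    using Hd[of "Suc k"]
    by (intro optimistic_ln_partition_sum_le[OF yS py HM HM HM Hd _ \<eta>]) (simp add: k)

  have G: "z \<bullet> G s = payoff A z (y s)" for z s by (simp add: G_def payoff_def)
  have H: "z \<bullet> H s = - payoff A (x s) z" for z s by (simp add: H_def payoff_transpose)
  \<comment> \<open>The zero-sum property cancels everything exactly: the cross payoffs of current
    against previous strategies occur once for each player, with opposite signs.\<close>
  have mean: "?x \<bullet> (2 *\<^sub>R ?g - ?gp) - (?xp - ?x) \<bullet> ?g + (?y \<bullet> (2 *\<^sub>R ?h - ?hp) - (?yp - ?y) \<bullet> ?h) = 0"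
    unfolding inner_diff_left unfolding inner_diff_right by (simp add: G H)

  have "payoff A xs ?yp - payoff A ?xp ys \<le> 2 * (payoff A xs ?y - payoff A ?x ys)"
  proof (rule optimal_gap_mono[OF opt xS xS yS yS])
    show "?xp $ i \<le> 2 * ?x $ i" for i
      unfolding px using GB[of "Suc k"] by (intro mw_step_stable(2)[OF xS _ \<delta>]) simp
    show "?yp $ j \<le> 2 * ?y $ j" for j
      unfolding py using HB[of "Suc k"] by (intro mw_step_stable(2)[OF yS _ \<delta>]) simp
  qed
  then have gap: "0 \<le> \<eta> * (xs \<bullet> (2 *\<^sub>R ?g - ?gp) + ys \<bullet> (2 *\<^sub>R ?h - ?hp))"
    using \<eta> by (intro mult_nonneg_nonneg) (simp_all add: inner_diff_right G H)

  have "KL_div xs ys (x (t + 1)) (y (t + 1)) = KL_div xs ys ?x ?y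
      - \<eta> * (xs \<bullet> (2 *\<^sub>R ?g - ?gp) + ys \<bullet> (2 *\<^sub>R ?h - ?hp))
      + ln (partition_sum ?x (\<eta> *\<^sub>R (2 *\<^sub>R ?g - ?gp))) + ln (partition_sum ?y (\<eta> *\<^sub>R (2 *\<^sub>R ?h - ?hp)))"
    unfolding KL_div_def sx sy sum_ln_ratio_mw_step[OF xsS xS xp] sum_ln_ratio_mw_step[OF ysS yS yp]
    by (simp add: algebra_simps)
  also have "\<dots> \<le> KL_div xs ys ?x ?y
      + \<eta> * (?x \<bullet> (2 *\<^sub>R ?g - ?gp) - (?xp - ?x) \<bullet> ?g + (?y \<bullet> (2 *\<^sub>R ?h - ?hp) - (?yp - ?y) \<bullet> ?h))
      - \<eta>\<^sup>2 / 2 * (weighted_var ?x ?g + weighted_var ?y ?h) + 816 * M ^ 3 * \<eta> ^ 3"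
    using lx ly gap by (simp only: distrib_left right_diff_distrib)
  finally show ?thesis unfolding mean by (simp add: G_def H_def)
qed

theorem theorem3p1:
  fixes A :: "real ^ 'm ^ 'n" and xs :: "real ^ 'n" and ys :: "real ^ 'm"
  assumes opt: "optimal_solution A xs ys"
    and uniq: "\<And>x y. optimal_solution A x y \<Longrightarrow> x = xs \<and> y = ys"
  shows "\<exists>\<eta>0 c C :: real. 0 < \<eta>0 \<and> \<eta>0 < 1 \<and> 0 < c \<and> 0 < C \<and>
    (\<forall>\<eta>. 0 < \<eta> \<and> \<eta> < \<eta>0 \<longrightarrow>
      (\<forall>(x :: nat \<Rightarrow> real ^ 'n) (y :: nat \<Rightarrow> real ^ 'm).
        omwu_dynamics A \<eta> x y \<and>
        x 0 = (\<chi> i. 1 / real CARD('n)) \<and> x 1 = (\<chi> i. 1 / real CARD('n)) \<and>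
        y 0 = (\<chi> j. 1 / real CARD('m)) \<and> y 1 = (\<chi> j. 1 / real CARD('m)) \<longrightarrow>
        (\<forall>t\<ge>2. \<not> alpha_close A (C * \<eta> powr (1 / 3)) (x t) (y t) \<longrightarrow>
          KL_div xs ys (x (t + 1)) (y (t + 1)) \<le> KL_div xs ys (x t) (y t) - c * \<eta> ^ 3)))"
proof -
  \<comment> \<open>The summand 1 ensures \<open>1 \<le> M\<close>, so that
    \<open>1 / (12 * M)\<close> is below 1 and \<open>M ^ 3\<close> can be bounded below by
    1.\<close>
  define M where "M = 1 + (\<Sum>i\<in>UNIV. \<Sum>j\<in>UNIV. \<bar>A $ i $ j\<bar>)"
  have M1: "1 \<le> M" by (simp add: M_def sum_nonneg)
  have M: "\<bar>A $ i $ j\<bar> \<le> M" for i j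
  proof -
    have "\<bar>A $ i $ j\<bar> \<le> (\<Sum>j\<in>UNIV. \<bar>A $ i $ j\<bar>)" by (rule member_le_sum) auto
    also have "\<dots> \<le> (\<Sum>i\<in>UNIV. \<Sum>j\<in>UNIV. \<bar>A $ i $ j\<bar>)"
      by (rule member_le_sum[where f = "\<lambda>i. \<Sum>j\<in>UNIV. \<bar>A $ i $ j\<bar>"]) (auto intro: sum_nonneg)
    finally show ?thesis by (simp add: M_def)
  qed
  have M3: "1 \<le> M ^ 3" using M1 by (rule one_le_power)
  have decrease: "KL_div xs ys (x (t + 1)) (y (t + 1)) \<le> KL_div xs ys (x t) (y t) - 1 * \<eta> ^ 3"
    if \<eta>: "0 < \<eta>" "\<eta> < 1 / (12 * M)" and dyn: "omwu_dynamics A \<eta> x y"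
      and init: "x 0 = (\<chi> i. 1 / real CARD('n))" "x 1 = (\<chi> i. 1 / real CARD('n))"
        "y 0 = (\<chi> j. 1 / real CARD('m))" "y 1 = (\<chi> j. 1 / real CARD('m))"
      and t: "2 \<le> t" and far: "\<not> alpha_close A (12 * M * \<eta> powr (1 / 3)) (x t) (y t)"
    for \<eta> x y t
  proof -
    let ?V = "weighted_var (x t) (A *v y t) + weighted_var (y t) (- (transpose A *v x t))"
    have "12 * M * \<eta> \<le> 1" using \<eta> M1 by (simp add: field_simps)
    note step = KL_div_omwu_step[OF opt M \<eta>(1) this dyn init t]
    have "(\<eta> powr (1 / 3)) ^ 3 = \<eta>" using \<eta> by (simp add: powr_powr flip: powr_numeral)
    \<comment> \<open>Half of 1728 is 864, which exceeds the error constant 816 by 48; hence the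
      radius factor \<open>12 * M\<close> and the choice of 1 for \<open>c\<close>.\<close>
    then have cube: "(12 * M * \<eta> powr (1 / 3)) ^ 3 = 1728 * M ^ 3 * \<eta>" by (simp add: power_mult_distrib)
    have "1728 * M ^ 3 * \<eta> < ?V"
      unfolding cube[symmetric] using omwu_dynamics_interior[OF dyn init, of t] far M1 \<eta>
      by (intro not_alpha_close_weighted_var) auto
    then have "\<eta>\<^sup>2 / 2 * (1728 * M ^ 3 * \<eta>) \<le> \<eta>\<^sup>2 / 2 * ?V" by (intro mult_left_mono) auto
    moreover have "\<eta>\<^sup>2 / 2 * (1728 * M ^ 3 * \<eta>) = 864 * M ^ 3 * \<eta> ^ 3"
      by (simp add: power_numeral_reduce)
    moreover have "1 * \<eta> ^ 3 \<le> 48 * M ^ 3 * \<eta> ^ 3"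
      using M3 \<eta> by (intro mult_right_mono) auto
    ultimately show ?thesis using step by linarith
  qed
  show ?thesis
    by (rule exI[of _ "1 / (12 * M)"], rule exI[of _ 1], rule exI[of _ "12 * M"])
      (use M1 decrease in \<open>auto simp: field_simps\<close>)
qed

end
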